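(* Let $R$ be a commutative noetherian ring, let $\mathcal{S}_1$ and $\mathcal{S}_2$ be two Serre subcategories of $R$-Mod, let $\mathfrak{a}$ be an ideal of $R$, and suppose that $\langle\mathcal{S}_1,\mathcal{S}_2\rangle$ and $\mathcal{S}_1\cap\mathcal{S}_2$ satisfy the $C_{\mathfrak{a}}$ condition. Then $\mathcal{S}_1$ and $\mathcal{S}_2$ satisfy the $C_{\mathfrak{a}}$ condition.
   Context: $R$-Mod is the category of $R$-modules; all subcategories are full (identified with their classes of objects). A subcategory is Serre if it is closed under taking submodules, quotients and extensions. For subcategories $\mathcal{S}_1,\mathcal{S}_2$ of $R$-Mod, $\langle\mathcal{S}_1,\mathcal{S}_2\rangle$ is the class of all $R$-modules $M$ for which there is an exact sequence $0\to M_1\to M\to M_2\to 0$ with $M_i\in\mathcal{S}_i$ for $i=1,2$. For an ideal $\mathfrak{a}$ and an $R$-module $M$, $\Gamma_{\mathfrak{a}}(M)=\{m\in M : \mathfrak{a}^k m=0 \text{ for some } k\ge 1\}$ and $(0:_M\mathfrak{a})=\{m\in M:\mathfrak{a}m=0\}$. A class $\mathcal{S}$ of $R$-modules satisfies the $C_{\mathfrak{a}}$ condition if for every $R$-module $M$: $\Gamma_{\mathfrak{a}}(M)=M$ and $(0:_M\mathfrak{a})\in\mathcal{S}$ imply $M\in\mathcal{S}$. *)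

theory Defs
  imports "HOL-Algebra.Algebra"
begin

text \<open>
  A class of \<open>R\<close>-modules is a set of module records over a carrier type \<open>'m\<close>, which is a free type
  variable and plays the role of the universe. The ring component of the type \<open>module\<close> also
  carries a multiplication and a unit on \<open>M\<close>; these have no meaning for a module, and no definition
  below depends on them.
\<close>

definition R_Mod :: "('r, 'x) ring_scheme \<Rightarrow> ('r, 'm) module set" where
  "R_Mod R = {M. module R M}"

definition mod_hom ::
  "('r, 'x) ring_scheme \<Rightarrow> ('r, 'm) module \<Rightarrow> ('r, 'm) module \<Rightarrow> ('m \<Rightarrow> 'm) set" where
  "mod_hom R M N = {f \<in> hom (add_monoid M) (add_monoid N).
     \<forall>r \<in> carrier R. \<forall>m \<in> carrier M. f (r \<odot>\<^bsub>M\<^esub> m) = r \<odot>\<^bsub>N\<^esub> f m}"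

definition mod_short_exact ::
  "('r, 'x) ring_scheme \<Rightarrow> ('r, 'm) module \<Rightarrow> ('m \<Rightarrow> 'm) \<Rightarrow> ('r, 'm) module \<Rightarrow> ('m \<Rightarrow> 'm)
     \<Rightarrow> ('r, 'm) module \<Rightarrow> bool" where
  "mod_short_exact R M1 f M g M2 \<longleftrightarrow>
     f \<in> mod_hom R M1 M \<and> g \<in> mod_hom R M M2 \<and>
     inj_on f (carrier M1) \<and>
     f ` carrier M1 = kernel (add_monoid M) (add_monoid M2) g \<and>
     g ` carrier M = carrier M2"

definition extension_class ::
  "('r, 'x) ring_scheme \<Rightarrow> ('r, 'm) module set \<Rightarrow> ('r, 'm) module set \<Rightarrow> ('r, 'm) module set" where
  "extension_class R S1 S2 =
     {M \<in> R_Mod R. \<exists>M1 \<in> S1. \<exists>M2 \<in> S2. \<exists>f g. mod_short_exact R M1 f M g M2}"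

text \<open>
  Quotients of \<open>M\<close> are rendered as codomains of surjective homomorphisms, because the carrier of a
  coset module would have type \<open>'m set\<close>. In particular a Serre subcategory is closed under
  isomorphism. As a subcategory of an abelian category it is understood to be nonempty, that is, to
  contain the zero module.
\<close>

definition serre_subcategory :: "('r, 'x) ring_scheme \<Rightarrow> ('r, 'm) module set \<Rightarrow> bool" where
  "serre_subcategory R S \<longleftrightarrow>
     S \<subseteq> R_Mod R \<and> S \<noteq> {} \<and>
     (\<forall>M \<in> S. \<forall>N. submodule N R M \<longrightarrow> M\<lparr>carrier := N\<rparr> \<in> S) \<and>
     (\<forall>M \<in> S. \<forall>Q \<in> R_Mod R. \<forall>g \<in> mod_hom R M Q. g ` carrier M = carrier Q \<longrightarrow> Q \<in> S) \<and>
     extension_class R S S \<subseteq> S"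

definition annihilated_part ::
  "'r set \<Rightarrow> ('r, 'm) module \<Rightarrow> 'm set" where
  "annihilated_part I M = {m \<in> carrier M. \<forall>x \<in> I. x \<odot>\<^bsub>M\<^esub> m = \<zero>\<^bsub>M\<^esub>}"

text \<open>The power is the \<open>k\<close>-th power of the ideal \<open>I\<close> in the monoid of ideals of \<open>R\<close>.\<close>

definition torsion_part ::
  "('r, 'x) ring_scheme \<Rightarrow> 'r set \<Rightarrow> ('r, 'm) module \<Rightarrow> 'm set" where
  "torsion_part R I M = {m \<in> carrier M.
     \<exists>k::nat. k \<ge> 1 \<and> (\<forall>x \<in> I [^]\<^bsub>ideals_set R\<^esub> k. x \<odot>\<^bsub>M\<^esub> m = \<zero>\<^bsub>M\<^esub>)}"

definition C_condition ::
  "('r, 'x) ring_scheme \<Rightarrow> 'r set \<Rightarrow> ('r, 'm) module set \<Rightarrow> bool" where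
  "C_condition R I S \<longleftrightarrow> (\<forall>M \<in> R_Mod R.
     torsion_part R I M = carrier M \<and> M\<lparr>carrier := annihilated_part I M\<rparr> \<in> S \<longrightarrow> M \<in> S)"

end

theory Submission
  imports Defs
begin

text \<open>
  Write \<open>(0 : M)\<close> for the part of \<open>M\<close> annihilated by \<open>\<aa>\<close>. Let \<open>M\<close> be \<open>\<aa>\<close>-torsion with \<open>(0 : M)\<close> in
  \<open>S1\<close> or in \<open>S2\<close>. Both classes lie in the class of extensions, so \<open>M\<close> is an extension of some
  \<open>M2 \<in> S2\<close> by a submodule \<open>N \<in> S1\<close>.

  If \<open>(0 : M) \<in> S2\<close>, then its submodule \<open>(0 : N)\<close> lies in \<open>S1 \<inter> S2\<close>, hence so does the torsion
  module \<open>N\<close>, and \<open>M\<close> is an extension of two modules in \<open>S2\<close>.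

  If \<open>(0 : M) \<in> S1\<close>, it suffices to show \<open>(0 : M2) \<in> S1\<close>, since then \<open>(0 : M2)\<close> and therefore the
  torsion module \<open>M2\<close> lie in \<open>S1 \<inter> S2\<close>, and \<open>M\<close> is an extension of two modules in \<open>S1\<close>. The usual
  argument bounds \<open>(0 : M2)\<close> by \<open>(0 : M)\<close> and \<open>Ext\<^sup>1(R/\<aa>, N)\<close>. The argument below is elementary and,
  moreover, never leaves the given universe of modules, in which powers such as \<open>N\<^sup>n\<close> need not exist.
  Let \<open>T\<close> be the preimage of \<open>(0 : M2)\<close> in \<open>M\<close>, so that \<open>\<aa> T \<subseteq> N\<close>, and choose finitely many
  generators \<open>a\<^sub>1, \<dots>, a\<^sub>n\<close> of \<open>\<aa>\<close>. In the chain of the submodules of \<open>T\<close> annihilated by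
  \<open>a\<^sub>1, \<dots>, a\<^sub>j\<close>, multiplication by \<open>a\<^sub>j\<^sub>+\<^sub>1\<close> embeds each successive quotient into \<open>N\<close>, and the last
  term is \<open>(0 : M)\<close> (\<open>serre_of_annihilated_part\<close>). Hence \<open>T\<close>, and with it its image \<open>(0 : M2)\<close>, is
  in \<open>S1\<close>.
\<close>

section \<open>Homomorphisms and submodules\<close>

lemma mod_homI:
  assumes "\<And>x. x \<in> carrier M \<Longrightarrow> f x \<in> carrier N"
    and "\<And>x y. \<lbrakk>x \<in> carrier M; y \<in> carrier M\<rbrakk> \<Longrightarrow> f (x \<oplus>\<^bsub>M\<^esub> y) = f x \<oplus>\<^bsub>N\<^esub> f y"
    and "\<And>r x. \<lbrakk>r \<in> carrier R; x \<in> carrier M\<rbrakk> \<Longrightarrow> f (r \<odot>\<^bsub>M\<^esub> x) = r \<odot>\<^bsub>N\<^esub> f x"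
  shows "f \<in> mod_hom R M N"
  using assms by (auto simp: mod_hom_def hom_def)

lemma mod_homD:
  assumes "f \<in> mod_hom R M N"
  shows "x \<in> carrier M \<Longrightarrow> f x \<in> carrier N"
    and "\<lbrakk>x \<in> carrier M; y \<in> carrier M\<rbrakk> \<Longrightarrow> f (x \<oplus>\<^bsub>M\<^esub> y) = f x \<oplus>\<^bsub>N\<^esub> f y"
    and "\<lbrakk>r \<in> carrier R; x \<in> carrier M\<rbrakk> \<Longrightarrow> f (r \<odot>\<^bsub>M\<^esub> x) = r \<odot>\<^bsub>N\<^esub> f x"
  using assms by (auto simp: mod_hom_def hom_def)

lemma mod_hom_zero:
  assumes "module R M" "module R N" "f \<in> mod_hom R M N"
  shows "f \<zero>\<^bsub>M\<^esub> = \<zero>\<^bsub>N\<^esub>"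
proof -
  interpret M: module R M by fact
  interpret N: module R N by fact
  have "f \<zero>\<^bsub>M\<^esub> = f (\<zero>\<^bsub>R\<^esub> \<odot>\<^bsub>M\<^esub> \<zero>\<^bsub>M\<^esub>)" by simp
  also have "\<dots> = \<zero>\<^bsub>R\<^esub> \<odot>\<^bsub>N\<^esub> f \<zero>\<^bsub>M\<^esub>"
    by (intro mod_homD(3)[OF assms(3)]) auto
  also have "\<dots> = \<zero>\<^bsub>N\<^esub>" using mod_homD(1)[OF assms(3)] by simp
  finally show ?thesis .
qed

lemma zero_mod_hom: "module R N \<Longrightarrow> (\<lambda>_. \<zero>\<^bsub>N\<^esub>) \<in> mod_hom R M N"
  by (rule mod_homI)
    (simp_all add: module.smult_r_null module.axioms abelian_group.axioms
      abelian_monoid.zero_closed abelian_monoid.l_zero)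

text \<open>Closure under additive inverses is automatic because \<open>- x = (- 1) x\<close>.\<close>

lemma submoduleI':
  assumes "module R M"
    and "H \<subseteq> carrier M" "\<zero>\<^bsub>M\<^esub> \<in> H"
    and "\<And>x y. \<lbrakk>x \<in> H; y \<in> H\<rbrakk> \<Longrightarrow> x \<oplus>\<^bsub>M\<^esub> y \<in> H"
    and smult: "\<And>r x. \<lbrakk>r \<in> carrier R; x \<in> H\<rbrakk> \<Longrightarrow> r \<odot>\<^bsub>M\<^esub> x \<in> H"
  shows "submodule H R M"
proof -
  interpret M: module R M by fact
  have "\<ominus>\<^bsub>M\<^esub> x \<in> H" if "x \<in> H" for x
    using smult[of "\<ominus>\<^bsub>R\<^esub> \<one>\<^bsub>R\<^esub>" x] that assms(2) by (auto simp: M.smult_l_minus subset_iff)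
  then show ?thesis using assms by (intro M.submoduleI) auto
qed

lemma submoduleD:
  assumes "submodule H R M"
  shows "x \<in> H \<Longrightarrow> x \<in> carrier M" "\<zero>\<^bsub>M\<^esub> \<in> H"
    and "\<lbrakk>x \<in> H; y \<in> H\<rbrakk> \<Longrightarrow> x \<oplus>\<^bsub>M\<^esub> y \<in> H"
    and "\<lbrakk>r \<in> carrier R; x \<in> H\<rbrakk> \<Longrightarrow> r \<odot>\<^bsub>M\<^esub> x \<in> H"
  using submodule.smult_closed[OF assms] submodule.axioms(1)[OF assms]
    subgroup.subset[of H "add_monoid M"] subgroup.one_closed[of H "add_monoid M"]
    subgroup.m_closed[of H "add_monoid M"]
  by auto

lemma submodule_module: "\<lbrakk>module R M; submodule H R M\<rbrakk> \<Longrightarrow> module R (M\<lparr>carrier := H\<rparr>)"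
  by (rule submodule.submodule_is_module)

lemma zero_submodule:
  assumes "module R M"
  shows "submodule {\<zero>\<^bsub>M\<^esub>} R M"
proof -
  interpret M: module R M by fact
  show ?thesis by (rule submoduleI'[OF assms]) auto
qed

lemma submodule_in_submodule:
  assumes "module R M" "submodule H R M" "submodule K R M" "H \<subseteq> K"
  shows "submodule H R (M\<lparr>carrier := K\<rparr>)"
  using submoduleD[OF assms(2)] assms(4)
  by (intro submoduleI'[OF submodule_module[OF assms(1,3)]]) auto

lemma submodule_vimage:
  assumes "module R M" "module R N" "f \<in> mod_hom R M N" "submodule L R N"
  shows "submodule {x \<in> carrier M. f x \<in> L} R M"
proof -
  interpret M: module R M by fact
  show ?thesis
    using submoduleD[OF assms(4)] mod_homD[OF assms(3)] mod_hom_zero[OF assms(1-3)]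
    by (intro submoduleI'[OF assms(1)]) auto
qed

lemma submodule_image:
  assumes "module R M" "module R N" "f \<in> mod_hom R M N"
  shows "submodule (f ` carrier M) R N"
proof (rule submoduleI'[OF assms(2)])
  interpret M: module R M by fact
  show "f ` carrier M \<subseteq> carrier N" using mod_homD(1)[OF assms(3)] by auto
  show "\<zero>\<^bsub>N\<^esub> \<in> f ` carrier M"
    using mod_hom_zero[OF assms] by (metis M.zero_closed imageI)
  show "x \<oplus>\<^bsub>N\<^esub> y \<in> f ` carrier M" if "x \<in> f ` carrier M" "y \<in> f ` carrier M" for x y
    using that mod_homD(2)[OF assms(3)] by (metis (no_types, lifting) M.add.m_closed imageE imageI)
  show "r \<odot>\<^bsub>N\<^esub> x \<in> f ` carrier M" if "r \<in> carrier R" "x \<in> f ` carrier M" for r x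
    using that mod_homD(3)[OF assms(3)] by (metis (no_types, lifting) M.smult_closed imageE imageI)
qed

lemma kernel_submodule:
  assumes "module R M" "module R N" "f \<in> mod_hom R M N"
  shows "submodule {x \<in> carrier M. f x = \<zero>\<^bsub>N\<^esub>} R M"
  using submodule_vimage[OF assms zero_submodule[OF assms(2)]] by simp

lemma smult_mod_hom:
  assumes "module R M" "r \<in> carrier R"
  shows "(\<lambda>x. r \<odot>\<^bsub>M\<^esub> x) \<in> mod_hom R M M"
proof (rule mod_homI)
  interpret M: module R M by fact
  fix s x assume "s \<in> carrier R" "x \<in> carrier M"
  then show "r \<odot>\<^bsub>M\<^esub> (s \<odot>\<^bsub>M\<^esub> x) = s \<odot>\<^bsub>M\<^esub> (r \<odot>\<^bsub>M\<^esub> x)"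
    using assms(2) by (metis M.smult_assoc1 M.R.m_comm)
qed (use assms in \<open>auto intro: module.smult_closed module.smult_r_distr\<close>)

section \<open>Annihilated and torsion parts\<close>

lemma annihilated_part_submodule:
  assumes "module R M" "I \<subseteq> carrier R"
  shows "submodule (annihilated_part I M) R M"
proof -
  interpret M: module R M by fact
  have "i \<odot>\<^bsub>M\<^esub> (r \<odot>\<^bsub>M\<^esub> x) = \<zero>\<^bsub>M\<^esub>"
    if "i \<in> I" "i \<odot>\<^bsub>M\<^esub> x = \<zero>\<^bsub>M\<^esub>" "r \<in> carrier R" "x \<in> carrier M" for i r x
    using mod_homD(3)[OF smult_mod_hom[OF assms(1)], of i r x] that assms(2) by auto
  then show ?thesis
    using assms(2) by (intro submoduleI'[OF assms(1)])
      (auto simp: annihilated_part_def M.smult_r_distr subset_iff)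
qed

text \<open>The ring elements that annihilate a fixed \<open>m\<close> form an ideal, so it suffices to test generators.\<close>

lemma annihilated_part_genideal:
  assumes "module R M" "A \<subseteq> carrier R"
  shows "annihilated_part (Idl\<^bsub>R\<^esub> A) M = annihilated_part A M"
proof
  interpret M: module R M by fact
  show "annihilated_part (Idl\<^bsub>R\<^esub> A) M \<subseteq> annihilated_part A M"
    using M.R.genideal_self[OF assms(2)] by (auto simp: annihilated_part_def)
  show "annihilated_part A M \<subseteq> annihilated_part (Idl\<^bsub>R\<^esub> A) M"
  proof
    fix m assume m: "m \<in> annihilated_part A M"
    then have mM: "m \<in> carrier M" by (simp add: annihilated_part_def)
    let ?J = "{r \<in> carrier R. r \<odot>\<^bsub>M\<^esub> m = \<zero>\<^bsub>M\<^esub>}"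
    have "ideal ?J R"
    proof (rule idealI)
      show "ring R" by (rule M.R.ring_axioms)
      have "\<ominus>\<^bsub>R\<^esub> r \<in> ?J" if "r \<in> ?J" for r
        using that mM by (auto simp: M.smult_l_minus)
      then show "subgroup ?J (add_monoid R)"
        using mM by (intro subgroup.intro) (auto simp: M.smult_l_distr a_inv_def[symmetric])
      fix r x assume r: "r \<in> ?J" and x: "x \<in> carrier R"
      then show l: "x \<otimes>\<^bsub>R\<^esub> r \<in> ?J"
        using mM by (auto simp: M.smult_assoc1)
      show "r \<otimes>\<^bsub>R\<^esub> x \<in> ?J"
        using l r x by (simp add: M.R.m_comm)
    qed
    moreover have "A \<subseteq> ?J" using m assms(2) by (auto simp: annihilated_part_def)
    ultimately have "Idl\<^bsub>R\<^esub> A \<subseteq> ?J" by (rule M.R.genideal_minimal)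
    then show "m \<in> annihilated_part (Idl\<^bsub>R\<^esub> A) M" using mM by (auto simp: annihilated_part_def)
  qed
qed

lemma annihilated_part_carrier_update:
  "K \<subseteq> carrier M \<Longrightarrow>
    annihilated_part I (M\<lparr>carrier := K\<rparr>) = annihilated_part I M \<inter> K"
  by (auto simp: annihilated_part_def)

lemma torsion_part_carrier_update:
  "K \<subseteq> carrier M \<Longrightarrow> torsion_part R I (M\<lparr>carrier := K\<rparr>) = torsion_part R I M \<inter> K"
  by (auto simp: torsion_part_def)

lemma torsion_part_surj_image:
  assumes "module R M" "module R N" "f \<in> mod_hom R M N" "f ` carrier M = carrier N"
    and "ideal I R" "torsion_part R I M = carrier M"
  shows "torsion_part R I N = carrier N"
proof
  show "torsion_part R I N \<subseteq> carrier N" by (auto simp: torsion_part_def)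
  show "carrier N \<subseteq> torsion_part R I N"
  proof
    interpret M: module R M by fact
    fix y assume "y \<in> carrier N"
    then obtain x where x: "x \<in> carrier M" "y = f x" using assms(4) by auto
    then have "x \<in> torsion_part R I M" using assms(6) by simp
    then obtain k :: nat where k: "k \<ge> 1" "\<And>r. r \<in> I [^]\<^bsub>ideals_set R\<^esub> k \<Longrightarrow> r \<odot>\<^bsub>M\<^esub> x = \<zero>\<^bsub>M\<^esub>"
      unfolding torsion_part_def by blast
    interpret ideals: semiring "ideals_set R" by (rule M.R.ideals_set_is_semiring)
    have "I [^]\<^bsub>ideals_set R\<^esub> k \<in> carrier (ideals_set R)"
      using assms(5) by (intro ideals.nat_pow_closed) (simp add: ideals_set_def)
    then have pow: "I [^]\<^bsub>ideals_set R\<^esub> k \<subseteq> carrier R"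
      by (auto simp: ideals_set_def dest: ideal.Icarr)
    have "r \<odot>\<^bsub>N\<^esub> y = \<zero>\<^bsub>N\<^esub>" if "r \<in> I [^]\<^bsub>ideals_set R\<^esub> k" for r
      using mod_homD(3)[OF assms(3), of r x] k(2)[OF that] mod_hom_zero[OF assms(1-3)] pow that x
      by auto
    then show "y \<in> torsion_part R I N"
      using \<open>y \<in> carrier N\<close> k(1) by (auto simp: torsion_part_def)
  qed
qed

section \<open>Extensions and Serre subcategories\<close>

text \<open>
  Up to isomorphism the submodule in an extension may be taken to be the kernel itself, and the
  quotient to be the image of a homomorphism. This removes the embedding from all later arguments.
\<close>

lemma extension_classI:
  assumes "module R M" "module R Q" "g \<in> mod_hom R M Q"
    and "M\<lparr>carrier := {x \<in> carrier M. g x = \<zero>\<^bsub>Q\<^esub>}\<rparr> \<in> S1"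
    and "Q\<lparr>carrier := g ` carrier M\<rparr> \<in> S2"
  shows "M \<in> extension_class R S1 S2"
proof -
  have "mod_short_exact R (M\<lparr>carrier := {x \<in> carrier M. g x = \<zero>\<^bsub>Q\<^esub>}\<rparr>) (\<lambda>x. x) M g
      (Q\<lparr>carrier := g ` carrier M\<rparr>)"
    unfolding mod_short_exact_def
    by (intro conjI mod_homI) (auto simp: kernel_def mod_homD[OF assms(3)])
  then show ?thesis using assms(1,4,5) unfolding extension_class_def R_Mod_def by blast
qed

context
  fixes R :: "('r, 'x) ring_scheme" and S :: "('r, 'm) module set"
  assumes serre: "serre_subcategory R S"
begin

lemma serre_module: "M \<in> S \<Longrightarrow> module R M"
  using serre by (auto simp: serre_subcategory_def R_Mod_def)

lemma serre_submodule: "\<lbrakk>M \<in> S; submodule H R M\<rbrakk> \<Longrightarrow> M\<lparr>carrier := H\<rparr> \<in> S"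
  using serre by (auto simp: serre_subcategory_def)

lemma serre_quotient:
  "\<lbrakk>M \<in> S; module R Q; g \<in> mod_hom R M Q; g ` carrier M = carrier Q\<rbrakk> \<Longrightarrow> Q \<in> S"
  using serre unfolding serre_subcategory_def R_Mod_def by blast

lemma serre_extension:
  assumes "module R M" "module R Q" "g \<in> mod_hom R M Q"
    and "M\<lparr>carrier := {x \<in> carrier M. g x = \<zero>\<^bsub>Q\<^esub>}\<rparr> \<in> S"
    and "Q\<lparr>carrier := g ` carrier M\<rparr> \<in> S"
  shows "M \<in> S"
  using extension_classI[OF assms] serre unfolding serre_subcategory_def by blast

lemma serre_smaller_submodule:
  assumes "module R M" "submodule H R M" "submodule K R M" "H \<subseteq> K"
    and "M\<lparr>carrier := K\<rparr> \<in> S"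
  shows "M\<lparr>carrier := H\<rparr> \<in> S"
  using serre_submodule[OF assms(5) submodule_in_submodule[OF assms(1-4)]] by simp

text \<open>
  A nonempty class closed under quotients contains every copy of the zero module, since any module
  maps onto it.
\<close>

lemma serre_zero_module:
  assumes "module R Z" "carrier Z = {\<zero>\<^bsub>Z\<^esub>}"
  shows "Z \<in> S"
proof -
  obtain M where M: "M \<in> S" using serre by (auto simp: serre_subcategory_def)
  interpret M: module R M by (rule serre_module[OF M])
  have "(\<lambda>_. \<zero>\<^bsub>Z\<^esub>) ` carrier M = carrier Z" using M.zero_closed assms(2) by auto
  with M assms(1) show ?thesis by (intro serre_quotient[OF M _ zero_mod_hom])
qed

text \<open>
  This stands in for the fact that \<open>Ext\<^sup>1(R/\<aa>, N)\<close> lies in \<open>S\<close>. Dropping one element \<open>a\<close> from the finite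
  set enlarges the annihilated part of \<open>M\<close>, but only within \<open>S\<close>: multiplication by \<open>a\<close> maps the
  larger part into \<open>N\<close>, and its kernel is the smaller one.
\<close>

lemma serre_of_annihilated_part:
  assumes "finite A" "A \<subseteq> carrier R" "module R M"
    and "submodule N R M" "M\<lparr>carrier := N\<rparr> \<in> S"
    and "\<And>a m. \<lbrakk>a \<in> A; m \<in> carrier M\<rbrakk> \<Longrightarrow> a \<odot>\<^bsub>M\<^esub> m \<in> N"
    and "M\<lparr>carrier := annihilated_part A M\<rparr> \<in> S"
  shows "M \<in> S"
  using assms(1,2,6,7)
proof (induction A rule: finite_induct)
  case empty
  have "annihilated_part {} M = carrier M" by (auto simp: annihilated_part_def)
  then show ?case using empty by simp
next
  case (insert a A)
  define P where "P = M\<lparr>carrier := annihilated_part A M\<rparr>"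
  have a: "a \<in> carrier R" and A: "A \<subseteq> carrier R" using insert.prems by auto
  have P: "module R P"
    unfolding P_def
    by (rule submodule_module[OF assms(3) annihilated_part_submodule[OF assms(3) A]])
  have PM: "carrier P \<subseteq> carrier M" by (auto simp: P_def annihilated_part_def)
  \<comment> \<open>The target is \<open>M\<close> rather than \<open>P\<close>, so that the image can be compared with \<open>N\<close>.\<close>
  have h: "(\<lambda>x. a \<odot>\<^bsub>M\<^esub> x) \<in> mod_hom R P M"
    using mod_homD[OF smult_mod_hom[OF assms(3) a]] PM
    by (intro mod_homI) (auto simp: P_def subset_iff)
  have "P \<in> S"
  proof (rule serre_extension[OF P assms(3) h])
    have "{x \<in> carrier P. a \<odot>\<^bsub>M\<^esub> x = \<zero>\<^bsub>M\<^esub>} = annihilated_part (insert a A) M"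
      by (auto simp: P_def annihilated_part_def)
    then show "P\<lparr>carrier := {x \<in> carrier P. a \<odot>\<^bsub>M\<^esub> x = \<zero>\<^bsub>M\<^esub>}\<rparr> \<in> S"
      using insert.prems(3) by (simp add: P_def)
    have "(\<lambda>x. a \<odot>\<^bsub>M\<^esub> x) ` carrier P \<subseteq> N" using insert.prems(2) PM by auto
    then show "M\<lparr>carrier := (\<lambda>x. a \<odot>\<^bsub>M\<^esub> x) ` carrier P\<rparr> \<in> S"
      by (rule serre_smaller_submodule[OF assms(3) submodule_image[OF P assms(3) h] assms(4)])
        (rule assms(5))
  qed
  then show ?case using insert by (auto simp: P_def)
qed

end

lemma extension_classE:
  assumes "serre_subcategory R S1" "serre_subcategory R S2" "M \<in> extension_class R S1 S2"
  obtains Q g where "Q \<in> S2" "g \<in> mod_hom R M Q" "g ` carrier M = carrier Q"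
    and "M\<lparr>carrier := {x \<in> carrier M. g x = \<zero>\<^bsub>Q\<^esub>}\<rparr> \<in> S1"
proof -
  obtain M1 Q f g where M: "module R M" and M1: "M1 \<in> S1" and Q: "Q \<in> S2"
    and ex: "mod_short_exact R M1 f M g Q"
    using assms(3) by (auto simp: extension_class_def R_Mod_def)
  have f: "f \<in> mod_hom R M1 M" and g: "g \<in> mod_hom R M Q" "g ` carrier M = carrier Q"
    and im: "f ` carrier M1 = {x \<in> carrier M. g x = \<zero>\<^bsub>Q\<^esub>}"
    using ex by (auto simp: mod_short_exact_def kernel_def)
  have "f \<in> mod_hom R M1 (M\<lparr>carrier := f ` carrier M1\<rparr>)"
    using mod_homD[OF f] by (intro mod_homI) auto
  moreover have "module R (M\<lparr>carrier := f ` carrier M1\<rparr>)"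
    by (rule submodule_module[OF M submodule_image[OF serre_module[OF assms(1) M1] M f]])
  ultimately have "M\<lparr>carrier := f ` carrier M1\<rparr> \<in> S1"
    by (intro serre_quotient[OF assms(1) M1]) auto
  then show ?thesis using that Q g im by simp
qed

lemma serre_left_subset_extension_class:
  assumes "serre_subcategory R S1" "serre_subcategory R S2"
  shows "S1 \<subseteq> extension_class R S1 S2"
proof
  fix M assume M: "M \<in> S1"
  interpret M: module R M by (rule serre_module[OF assms(1) M])
  have "(\<lambda>_. \<zero>\<^bsub>M\<^esub>) ` carrier M = {\<zero>\<^bsub>M\<^esub>}" using M.zero_closed by auto
  moreover have "M\<lparr>carrier := {\<zero>\<^bsub>M\<^esub>}\<rparr> \<in> S2"
    by (rule serre_zero_module[OF assms(2)
        submodule_module[OF M.module_axioms zero_submodule[OF M.module_axioms]]]) simp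
  ultimately show "M \<in> extension_class R S1 S2"
    using M by (intro extension_classI[OF M.module_axioms M.module_axioms
          zero_mod_hom[OF M.module_axioms]]) auto
qed

lemma serre_right_subset_extension_class:
  assumes "serre_subcategory R S1" "serre_subcategory R S2"
  shows "S2 \<subseteq> extension_class R S1 S2"
proof
  fix M assume M: "M \<in> S2"
  interpret M: module R M by (rule serre_module[OF assms(2) M])
  have "{x \<in> carrier M. x = \<zero>\<^bsub>M\<^esub>} = {\<zero>\<^bsub>M\<^esub>}" by auto
  moreover have "M\<lparr>carrier := {\<zero>\<^bsub>M\<^esub>}\<rparr> \<in> S1"
    by (rule serre_zero_module[OF assms(1)
        submodule_module[OF M.module_axioms zero_submodule[OF M.module_axioms]]]) simp
  ultimately show "M \<in> extension_class R S1 S2"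
    using M by (intro extension_classI[where g = "\<lambda>x. x", OF M.module_axioms M.module_axioms])
      (auto intro: mod_homI)
qed

section \<open>The \<open>C\<close> condition\<close>

lemma C_conditionD:
  "\<lbrakk>C_condition R I S; module R M; torsion_part R I M = carrier M;
    M\<lparr>carrier := annihilated_part I M\<rparr> \<in> S\<rbrakk> \<Longrightarrow> M \<in> S"
  by (simp add: C_condition_def R_Mod_def)

lemma C_condition_right:
  assumes "serre_subcategory R S1" "serre_subcategory R S2" "ideal I R"
    and "C_condition R I (extension_class R S1 S2)" "C_condition R I (S1 \<inter> S2)"
  shows "C_condition R I S2"
  unfolding C_condition_def R_Mod_def
proof (intro ballI impI, elim conjE, unfold mem_Collect_eq)
  fix M assume M: "module R M" and tors: "torsion_part R I M = carrier M"
    and ann: "M\<lparr>carrier := annihilated_part I M\<rparr> \<in> S2"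
  have I: "I \<subseteq> carrier R" using assms(3) by (auto dest: ideal.Icarr)
  have "M \<in> extension_class R S1 S2"
    using serre_right_subset_extension_class[OF assms(1,2)] ann C_conditionD[OF assms(4) M tors]
    by blast
  then obtain Q g where Q: "Q \<in> S2" and g: "g \<in> mod_hom R M Q" "g ` carrier M = carrier Q"
    and ker: "M\<lparr>carrier := {x \<in> carrier M. g x = \<zero>\<^bsub>Q\<^esub>}\<rparr> \<in> S1"
    by (rule extension_classE[OF assms(1,2)])
  note Qm = serre_module[OF assms(2) Q]
  define N where "N = {x \<in> carrier M. g x = \<zero>\<^bsub>Q\<^esub>}"
  have N: "submodule N R M" unfolding N_def by (rule kernel_submodule[OF M Qm g(1)])
  have NM: "N \<subseteq> carrier M" by (auto simp: N_def)
  note Nm = submodule_module[OF M N]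
  have N1: "M\<lparr>carrier := N\<rparr> \<in> S1" using ker by (simp add: N_def)
  have annN: "submodule (annihilated_part I (M\<lparr>carrier := N\<rparr>)) R (M\<lparr>carrier := N\<rparr>)"
    by (rule annihilated_part_submodule[OF Nm I])
  have eq: "annihilated_part I (M\<lparr>carrier := N\<rparr>) = annihilated_part I M \<inter> N"
    by (rule annihilated_part_carrier_update[OF NM])
  have "M\<lparr>carrier := annihilated_part I M \<inter> N\<rparr> \<in> S1"
    using serre_submodule[OF assms(1) N1 annN] eq by simp
  moreover have "submodule (annihilated_part I M \<inter> N) R M"
    using submoduleD[OF N] submoduleD[OF annihilated_part_submodule[OF M I]]
    by (intro submoduleI'[OF M]) auto
  then have "M\<lparr>carrier := annihilated_part I M \<inter> N\<rparr> \<in> S2"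
    by (rule serre_smaller_submodule[OF assms(2) M _ annihilated_part_submodule[OF M I] _ ann]) auto
  ultimately have "M\<lparr>carrier := N\<rparr> \<in> S1 \<inter> S2"
    using tors NM eq
    by (intro C_conditionD[OF assms(5) Nm]) (auto simp: torsion_part_carrier_update)
  then show "M \<in> S2"
    using Q g by (intro serre_extension[OF assms(2) M Qm g(1)]) (auto simp: N_def)
qed

lemma C_condition_left:
  assumes "noetherian_ring R"
    and "serre_subcategory R S1" "serre_subcategory R S2" "ideal I R"
    and "C_condition R I (extension_class R S1 S2)" "C_condition R I (S1 \<inter> S2)"
  shows "C_condition R I S1"
  unfolding C_condition_def R_Mod_def
proof (intro ballI impI, elim conjE, unfold mem_Collect_eq)
  fix M assume M: "module R M" and tors: "torsion_part R I M = carrier M"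
    and ann: "M\<lparr>carrier := annihilated_part I M\<rparr> \<in> S1"
  have I: "I \<subseteq> carrier R" using assms(4) by (auto dest: ideal.Icarr)
  obtain A where A: "finite A" "A \<subseteq> carrier R" "I = Idl\<^bsub>R\<^esub> A"
    using noetherian_ring.finetely_gen[OF assms(1,4)] by auto
  interpret M: module R M by (rule M)
  have AI: "A \<subseteq> I" using M.R.genideal_self[OF A(2)] A(3) by simp
  have "M \<in> extension_class R S1 S2"
    using serre_left_subset_extension_class[OF assms(2,3)] ann C_conditionD[OF assms(5) M tors]
    by blast
  then obtain Q g where Q: "Q \<in> S2" and g: "g \<in> mod_hom R M Q" "g ` carrier M = carrier Q"
    and ker: "M\<lparr>carrier := {x \<in> carrier M. g x = \<zero>\<^bsub>Q\<^esub>}\<rparr> \<in> S1"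
    by (rule extension_classE[OF assms(2,3)])
  note Qm = serre_module[OF assms(3) Q]
  note annQ = annihilated_part_submodule[OF Qm I]
  define N where "N = {x \<in> carrier M. g x = \<zero>\<^bsub>Q\<^esub>}"
  define T where "T = {x \<in> carrier M. g x \<in> annihilated_part I Q}"
  have N: "submodule N R M" unfolding N_def by (rule kernel_submodule[OF M Qm g(1)])
  have T: "submodule T R M" unfolding T_def by (rule submodule_vimage[OF M Qm g(1) annQ])
  note Tm = submodule_module[OF M T]
  have TM: "T \<subseteq> carrier M" by (auto simp: T_def)
  have NT: "N \<subseteq> T" using submoduleD(2)[OF annQ] by (auto simp: N_def T_def)
  have annT: "annihilated_part I M \<subseteq> T"
  proof
    fix x assume x: "x \<in> annihilated_part I M"
    then have xM: "x \<in> carrier M" by (simp add: annihilated_part_def)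
    have "r \<odot>\<^bsub>Q\<^esub> g x = \<zero>\<^bsub>Q\<^esub>" if "r \<in> I" for r
      using mod_homD(3)[OF g(1), of r x] that x xM I mod_hom_zero[OF M Qm g(1)]
      by (auto simp: annihilated_part_def)
    then show "x \<in> T" using xM mod_homD(1)[OF g(1) xM] by (simp add: T_def annihilated_part_def)
  qed
  have T1: "M\<lparr>carrier := T\<rparr> \<in> S1"
  proof (rule serre_of_annihilated_part[OF assms(2) A(1,2) Tm])
    show "submodule N R (M\<lparr>carrier := T\<rparr>)" by (rule submodule_in_submodule[OF M N T NT])
    show "M\<lparr>carrier := T, carrier := N\<rparr> \<in> S1" using ker by (simp add: N_def)
    have "annihilated_part A (M\<lparr>carrier := T\<rparr>) = annihilated_part I M"
      using annT annihilated_part_genideal[OF M A(2)] A(3)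
      by (auto simp: annihilated_part_carrier_update[OF TM])
    then show "M\<lparr>carrier := T, carrier := annihilated_part A (M\<lparr>carrier := T\<rparr>)\<rparr> \<in> S1"
      using ann by simp
    fix a m assume a: "a \<in> A" and "m \<in> carrier (M\<lparr>carrier := T\<rparr>)"
    then have m: "m \<in> carrier M" "g m \<in> annihilated_part I Q" by (auto simp: T_def)
    have aI: "a \<in> I" and aR: "a \<in> carrier R" using a AI I by auto
    then show "a \<odot>\<^bsub>M\<lparr>carrier := T\<rparr>\<^esub> m \<in> N"
      using m mod_homD(3)[OF g(1) aR m(1)] by (simp add: N_def annihilated_part_def)
  qed
  have "Q\<lparr>carrier := annihilated_part I Q\<rparr> \<in> S1"
  proof (rule serre_quotient[OF assms(2) T1 submodule_module[OF Qm annQ]])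
    show "g \<in> mod_hom R (M\<lparr>carrier := T\<rparr>) (Q\<lparr>carrier := annihilated_part I Q\<rparr>)"
      using mod_homD[OF g(1)] by (intro mod_homI) (auto simp: T_def)
    have "annihilated_part I Q \<subseteq> g ` carrier M" using g(2) by (auto simp: annihilated_part_def)
    then show "g ` carrier (M\<lparr>carrier := T\<rparr>) = carrier (Q\<lparr>carrier := annihilated_part I Q\<rparr>)"
      by (auto simp: T_def)
  qed
  moreover have "Q\<lparr>carrier := annihilated_part I Q\<rparr> \<in> S2"
    by (rule serre_submodule[OF assms(3) Q annQ])
  ultimately have "Q \<in> S1 \<inter> S2"
    by (intro C_conditionD[OF assms(6) Qm torsion_part_surj_image[OF M Qm g assms(4) tors]]) simp
  then show "M \<in> S1"
    using ker g by (intro serre_extension[OF assms(2) M Qm g(1)]) auto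
qed

theorem theorem2p12:
  fixes R :: "('r, 'x) ring_scheme"
    and S1 S2 :: "('r, 'm) module set"
    and \<aa> :: "'r set"
  assumes "cring R" and "noetherian_ring R"
    and "serre_subcategory R S1" and "serre_subcategory R S2"
    and "ideal \<aa> R"
    and "C_condition R \<aa> (extension_class R S1 S2)"
    and "C_condition R \<aa> (S1 \<inter> S2)"
  shows "C_condition R \<aa> S1 \<and> C_condition R \<aa> S2"
  using C_condition_left[OF assms(2-7)] C_condition_right[OF assms(3-7)] by blast

end
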